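(* Let $(\mathcal{P}^{\text{co}}_{\mathcal{E}_t})_{t\ge 0}$ be the sequence of DIPK belief sets on $(\Omega,\mathcal{F})$ defined in the context, with lower and upper probabilities $\underline{P}_{\mathcal{E}_t},\overline{P}_{\mathcal{E}_t}$ and generalized Bayes' conditional lower and upper probabilities $\underline{P}^B_{\mathcal{E}_t},\overline{P}^B_{\mathcal{E}_t}$. For any $A\in\mathcal{F}$ and any $t\in\mathbb{N}$, $$\underline{P}_{\mathcal{E}_{t+1}}(A)\ \ge\ \sum_{E_j\in\mathcal{E}_{t+1}}\underline{P}^B_{\mathcal{E}_t}(A\mid E_j)\left[\beta(n_{t+1})\underline{P}_{\mathcal{E}_t}(E_j)+(1-\beta(n_{t+1}))P^{emp}_{t+1}(E_j)\right]$$ and $$\overline{P}_{\mathcal{E}_{t+1}}(A)\ \le\ \sum_{E_j\in\mathcal{E}_{t+1}}\overline{P}^B_{\mathcal{E}_t}(A\mid E_j)\left[\beta(n_{t+1})\overline{P}_{\mathcal{E}_t}(E_j)+(1-\beta(n_{t+1}))P^{emp}_{t+1}(E_j)\right].$$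
   Context: $\Omega$ is at most countable, $\mathcal{F}=2^\Omega$, $\Delta(\Omega,\mathcal{F})$ is the set of probability measures on $(\Omega,\mathcal{F})$, $X:\Omega\to\mathcal{X}$ is a function, $(x_i)_{i\ge1}$ is a sequence of data points in $X(\Omega)$, $0=n_0<n_1<n_2<\cdots$ are integers, $\beta$ takes values in $[0,1]$, $\mathbb{N}=\{1,2,\dots\}$. DPK update of a measure. At time $t\ge 1$ the data $x_1,\dots,x_{n_t}$ are available. Let $E_1,\dots,E_m$ be the distinct sets among $X^{-1}(x_1),\dots,X^{-1}(x_{n_t})$, $E_{m+1}=\Omega\setminus\bigcup_{j=1}^m E_j$, and $\mathcal{E}_t=\{E_1,\dots,E_{m+1}\}$. If $E_{m+1}\ne\emptyset$, $P^{emp}_t(E_j)=\frac{1}{n_t+1}\#\{i\le n_t: X^{-1}(x_i)=E_j\}$ for $j\le m$ and $P^{emp}_t(E_{m+1})=1-\sum_{j=1}^m P^{emp}_t(E_j)$; if $E_{m+1}=\emptyset$, $P^{emp}_t(E_j)=\frac{1}{n_t}\#\{i\le n_t: X^{-1}(x_i)=E_j\}$ for $j\le m$ and $P^{emp}_t(E_{m+1})=0$. The time-$t$ DPK update of $P_{\mathcal{E}_{t-1}}\in\Delta(\Omega,\mathcal{F})$ is $P_{\mathcal{E}_t}(A)=\sum_{E_j\in\mathcal{E}_t}P_{\mathcal{E}_{t-1}}(A\mid E_j)P_{\mathcal{E}_t}(E_j)$, $A\in\mathcal{F}$, with $P_{\mathcal{E}_t}(E_j)=\beta(n_t)P_{\mathcal{E}_{t-1}}(E_j)+[1-\beta(n_t)]P^{emp}_t(E_j)$.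 Terms with $E_j=\emptyset$ are $0$ in all sums. DIPK. The agent specifies a set $\mathcal{P}\subset\Delta(\Omega,\mathcal{F})$ with lower probability $\underline{P}(A)=\inf_{P\in\mathcal{P}}P(A)$. The initial belief set is $\mathcal{P}^{\text{co}}_{\mathcal{E}_0}=\text{core}(\underline{P})=\{P\in\Delta(\Omega,\mathcal{F}):P(A)\ge\underline{P}(A)\ \forall A\in\mathcal{F}\}$, and $\mathcal{P}_{\mathcal{E}_0}$ is its set of extreme points, assumed finite, with $\mathcal{P}^{\text{co}}_{\mathcal{E}_0}=\text{Conv}(\mathcal{P}_{\mathcal{E}_0})$ and with every $P\in\mathcal{P}_{\mathcal{E}_0}$ positive on all nonempty events. For $t\ge1$, $\mathcal{P}_{\mathcal{E}_t}$ is the set of time-$t$ DPK updates of the elements of $\mathcal{P}_{\mathcal{E}_{t-1}}$, and $\mathcal{P}^{\text{co}}_{\mathcal{E}_t}=\text{Conv}(\mathcal{P}_{\mathcal{E}_t})$ (convex hull). Put $\underline{P}_{\mathcal{E}_t}(A)=\inf_{P\in\mathcal{P}^{\text{co}}_{\mathcal{E}_t}}P(A)$ and $\overline{P}_{\mathcal{E}_t}(A)=\sup_{P\in\mathcal{P}^{\text{co}}_{\mathcal{E}_t}}P(A)=1-\underline{P}_{\mathcal{E}_t}(A^c)$. Generalized Bayes' conditional lower and upper probabilities: $\underline{P}^B_{\mathcal{E}_t}(A\mid E)=\inf_{P\in\mathcal{P}^{\text{co}}_{\mathcal{E}_t}}\frac{P(A\cap E)}{P(E)}$ and $\overline{P}^B_{\mathcal{E}_t}(A\mid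 E)=\sup_{P\in\mathcal{P}^{\text{co}}_{\mathcal{E}_t}}\frac{P(A\cap E)}{P(E)}$. *)

theory Defs
  imports "HOL-Probability.Probability"
begin

definition prob_measures :: "'w set \<Rightarrow> 'w measure set" where
  "prob_measures \<Omega> = {P. prob_space P \<and> sets P = Pow \<Omega>}"


subsection \<open>Data partition and DPK updating\<close>

definition fiber :: "'w set \<Rightarrow> ('w \<Rightarrow> 'x) \<Rightarrow> 'x \<Rightarrow> 'w set" where
  "fiber \<Omega> X y = X -` {y} \<inter> \<Omega>"

text \<open>Below, \<open>x 1, x 2, \<dots>\<close> are the data points (\<open>x 0\<close> is never used) and \<open>N\<close> is the number of
  data points observed so far, i.e. \<open>n t\<close> at time \<open>t\<close>. The set \<open>data_cells\<close> is \<open>{E\<^sub>1, \<dots>, E\<^sub>m}\<close>, the set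
  \<open>residual_cell\<close> is \<open>E\<^sub>m\<^sub>+\<^sub>1\<close>.\<close>

definition data_cells :: "'w set \<Rightarrow> ('w \<Rightarrow> 'x) \<Rightarrow> (nat \<Rightarrow> 'x) \<Rightarrow> nat \<Rightarrow> 'w set set" where
  "data_cells \<Omega> X x N = (\<lambda>i. fiber \<Omega> X (x i)) ` {1..N}"

definition residual_cell :: "'w set \<Rightarrow> ('w \<Rightarrow> 'x) \<Rightarrow> (nat \<Rightarrow> 'x) \<Rightarrow> nat \<Rightarrow> 'w set" where
  "residual_cell \<Omega> X x N = \<Omega> - \<Union>(data_cells \<Omega> X x N)"

definition cells :: "'w set \<Rightarrow> ('w \<Rightarrow> 'x) \<Rightarrow> (nat \<Rightarrow> 'x) \<Rightarrow> nat \<Rightarrow> 'w set set" where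
  "cells \<Omega> X x N = insert (residual_cell \<Omega> X x N) (data_cells \<Omega> X x N)"

definition hits :: "'w set \<Rightarrow> ('w \<Rightarrow> 'x) \<Rightarrow> (nat \<Rightarrow> 'x) \<Rightarrow> nat \<Rightarrow> 'w set \<Rightarrow> nat" where
  "hits \<Omega> X x N E = card {i \<in> {1..N}. fiber \<Omega> X (x i) = E}"

text \<open>Only used for \<open>E\<close> in \<open>cells \<Omega> X x N\<close>. When the data lie in \<open>X ` \<Omega>\<close>, the data cells are
  nonempty, so \<open>residual_cell\<close> is not one of them and the case distinction is unambiguous.\<close>

definition emp :: "'w set \<Rightarrow> ('w \<Rightarrow> 'x) \<Rightarrow> (nat \<Rightarrow> 'x) \<Rightarrow> nat \<Rightarrow> 'w set \<Rightarrow> real" where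
  "emp \<Omega> X x N E =
     (if residual_cell \<Omega> X x N \<noteq> {} then
        (if E \<in> data_cells \<Omega> X x N then real (hits \<Omega> X x N E) / real (N + 1)
         else 1 - (\<Sum>D \<in> data_cells \<Omega> X x N. real (hits \<Omega> X x N D) / real (N + 1)))
      else
        (if E \<in> data_cells \<Omega> X x N then real (hits \<Omega> X x N E) / real N
         else 0))"

definition cond_pr :: "'w measure \<Rightarrow> 'w set \<Rightarrow> 'w set \<Rightarrow> real" where
  "cond_pr P A E = measure P (A \<inter> E) / measure P E"

text \<open>Terms with an empty cell count as \<open>0\<close> in all sums, hence the summation over
  \<open>cells \<Omega> X x N - {{}}\<close>. The probability measures on \<open>(\<Omega>, Pow \<Omega>)\<close> are treated as genuine measures,
  so the set function defining the update is turned into one by \<^const>\<open>measure_of\<close>.\<close>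

definition dpk_update ::
  "'w set \<Rightarrow> ('w \<Rightarrow> 'x) \<Rightarrow> (nat \<Rightarrow> 'x) \<Rightarrow> (nat \<Rightarrow> real) \<Rightarrow> nat \<Rightarrow> 'w measure \<Rightarrow> 'w measure" where
  "dpk_update \<Omega> X x \<beta> N P = measure_of \<Omega> (Pow \<Omega>)
     (\<lambda>A. ennreal (\<Sum>E \<in> cells \<Omega> X x N - {{}}.
        cond_pr P A E * (\<beta> N * measure P E + (1 - \<beta> N) * emp \<Omega> X x N E)))"


subsection \<open>Sets of probability measures\<close>

definition lower_prob :: "'w measure set \<Rightarrow> 'w set \<Rightarrow> real" where
  "lower_prob C A = (INF P \<in> C. measure P A)"

definition upper_prob :: "'w measure set \<Rightarrow> 'w set \<Rightarrow> real" where
  "upper_prob C A = (SUP P \<in> C. measure P A)"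

definition lower_bayes :: "'w measure set \<Rightarrow> 'w set \<Rightarrow> 'w set \<Rightarrow> real" where
  "lower_bayes C A E = (INF P \<in> C. cond_pr P A E)"

definition upper_bayes :: "'w measure set \<Rightarrow> 'w set \<Rightarrow> 'w set \<Rightarrow> real" where
  "upper_bayes C A E = (SUP P \<in> C. cond_pr P A E)"

definition core :: "'w set \<Rightarrow> ('w set \<Rightarrow> real) \<Rightarrow> 'w measure set" where
  "core \<Omega> L = {P \<in> prob_measures \<Omega>. \<forall>A\<subseteq>\<Omega>. L A \<le> measure P A}"

text \<open>Measures do not form a real vector space, so \<^const>\<open>convex\<close>, \<open>convex hull\<close> and
  \<^const>\<open>extreme_point_of\<close> do not apply to them; the next two definitions are the usual ones, with
  convex combinations taken setwise.\<close>

definition conv :: "'w set \<Rightarrow> 'w measure set \<Rightarrow> 'w measure set" where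
  "conv \<Omega> C = {P \<in> prob_measures \<Omega>.
     \<exists>F u. finite F \<and> F \<subseteq> C \<and> (\<forall>Q\<in>F. 0 \<le> u Q) \<and> (\<Sum>Q\<in>F. u Q) = 1 \<and>
       (\<forall>A\<subseteq>\<Omega>. measure P A = (\<Sum>Q\<in>F. u Q * measure Q A))}"

definition extreme_points :: "'w set \<Rightarrow> 'w measure set \<Rightarrow> 'w measure set" where
  "extreme_points \<Omega> C = {P \<in> C. \<not> (\<exists>Q\<in>C. \<exists>R\<in>C. \<exists>u::real. Q \<noteq> R \<and> 0 < u \<and> u < 1 \<and>
     (\<forall>A\<subseteq>\<Omega>. measure P A = (1 - u) * measure Q A + u * measure R A))}"


subsection \<open>The DIPK belief sets\<close>

primrec dipk_extremes ::
  "'w set \<Rightarrow> ('w \<Rightarrow> 'x) \<Rightarrow> (nat \<Rightarrow> 'x) \<Rightarrow> (nat \<Rightarrow> nat) \<Rightarrow> (nat \<Rightarrow> real) \<Rightarrow> 'w measure set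
    \<Rightarrow> nat \<Rightarrow> 'w measure set" where
  "dipk_extremes \<Omega> X x n \<beta> \<P> 0 = extreme_points \<Omega> (core \<Omega> (lower_prob \<P>))"
| "dipk_extremes \<Omega> X x n \<beta> \<P> (Suc t) =
     dpk_update \<Omega> X x \<beta> (n (Suc t)) ` dipk_extremes \<Omega> X x n \<beta> \<P> t"

definition dipk_beliefs ::
  "'w set \<Rightarrow> ('w \<Rightarrow> 'x) \<Rightarrow> (nat \<Rightarrow> 'x) \<Rightarrow> (nat \<Rightarrow> nat) \<Rightarrow> (nat \<Rightarrow> real) \<Rightarrow> 'w measure set
    \<Rightarrow> nat \<Rightarrow> 'w measure set" where
  "dipk_beliefs \<Omega> X x n \<beta> \<P> t =
     (if t = 0 then core \<Omega> (lower_prob \<P>) else conv \<Omega> (dipk_extremes \<Omega> X x n \<beta> \<P> t))"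

end

theory Submission
  imports Defs
begin

text \<open>The belief set at time \<open>t + 1\<close> is spanned by the updates of the measures \<open>P\<close> spanning the
  belief set at time \<open>t\<close>, and the value of such an update at \<open>A\<close> is the sum
  over the cells \<open>E\<close> of a product of two nonnegative factors: the conditional probability
  \<open>P(A | E)\<close> and the weight \<open>\<beta> P(E) + (1 - \<beta>) P\<^sup>e\<^sup>m\<^sup>p(E)\<close>.
  Replacing each factor by its infimum (supremum) over all beliefs at time \<open>t\<close> can only decrease (increase)
  the sum, which gives a bound that is the same for all \<open>P\<close> and therefore survives convex
  combinations; this is the content of \<open>dpk_update_ge\<close>, \<open>dpk_update_le\<close>, \<open>conv_ge\<close> and
  \<open>conv_le\<close>.

  The remaining work makes these steps meaningful. The update is a priori only a set function
  wrapped into a measure: it is countably additive because conditional probabilities are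
  (\<open>measure_dpk_update\<close>), and it has total mass \<open>1\<close> because the weights sum to \<open>1\<close> over the
  nonempty cells and conditioning on each of them is well defined. The latter needs every belief
  to give positive mass to every nonempty event. This property is preserved by updating, since the
  empirical distribution is positive on every nonempty cell (\<open>emp_pos\<close>): data cells have been hit
  at least once, and a nonempty residual cell is given mass \<open>1 / (N + 1)\<close>. Hence all
  spanning measures are probability measures and belong to the belief set they span. Finally, the
  belief sets are nonempty, so that infima and suprema over them are bounded by common bounds of
  their elements.\<close>

section \<open>The data partition and its empirical distribution\<close>

lemma finite_data_cells: "finite (data_cells \<Omega> X x N)"
  by (simp add: data_cells_def)

lemma finite_cells: "finite (cells \<Omega> X x N)"
  by (simp add: cells_def finite_data_cells)

lemma data_cells_subset: "D \<in> data_cells \<Omega> X x N \<Longrightarrow> D \<subseteq> \<Omega>"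
  by (auto simp: data_cells_def fiber_def)

lemma cells_subset: "E \<in> cells \<Omega> X x N \<Longrightarrow> E \<subseteq> \<Omega>"
  by (auto simp: cells_def residual_cell_def dest: data_cells_subset)

lemma Union_cells: "\<Union>(cells \<Omega> X x N - {{}}) = \<Omega>"
proof
  show "\<Union>(cells \<Omega> X x N - {{}}) \<subseteq> \<Omega>"
    using cells_subset by fastforce
  show "\<Omega> \<subseteq> \<Union>(cells \<Omega> X x N - {{}})"
    unfolding cells_def residual_cell_def by blast
qed

lemma disjoint_cells: "disjoint (cells \<Omega> X x N)"
proof -
  have "D \<inter> E = {}" if "D \<in> data_cells \<Omega> X x N" "E \<in> data_cells \<Omega> X x N" "D \<noteq> E" for D E
    using that by (auto simp: data_cells_def fiber_def)
  moreover have "residual_cell \<Omega> X x N \<inter> D = {}" if "D \<in> data_cells \<Omega> X x N" for D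
    using that unfolding residual_cell_def by blast
  ultimately show ?thesis
    unfolding disjoint_def cells_def by (metis Int_commute insertE)
qed

lemma sum_hits: "(\<Sum>D\<in>data_cells \<Omega> X x N. real (hits \<Omega> X x N D)) = real N"
proof -
  have "(\<Sum>i\<in>{1..N}. 1) =
      (\<Sum>D\<in>data_cells \<Omega> X x N. \<Sum>i\<in>{i \<in> {1..N}. fiber \<Omega> X (x i) = D}. 1 :: real)"
    unfolding data_cells_def by (rule sum.image_gen) simp
  then show ?thesis
    by (simp add: hits_def)
qed

lemma hits_pos: "D \<in> data_cells \<Omega> X x N \<Longrightarrow> 0 < hits \<Omega> X x N D"
  by (auto simp: hits_def data_cells_def card_gt_0_iff)

lemma data_cells_nonempty:
  assumes "\<forall>i\<ge>1. x i \<in> X ` \<Omega>" "D \<in> data_cells \<Omega> X x N"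
  shows "D \<noteq> {}"
proof -
  obtain i where i: "i \<in> {1..N}" "D = fiber \<Omega> X (x i)"
    using assms(2) by (auto simp: data_cells_def)
  then have "x i \<in> X ` \<Omega>"
    using assms(1) by simp
  then show ?thesis
    using i by (auto simp: fiber_def)
qed

lemma residual_cell_notin_data_cells:
  "residual_cell \<Omega> X x N \<noteq> {} \<Longrightarrow> residual_cell \<Omega> X x N \<notin> data_cells \<Omega> X x N"
  unfolding residual_cell_def by blast

text \<open>The hits of the data cells add up to \<open>N\<close>, so with the denominator \<open>N + 1\<close> exactly one unit out
  of \<open>N + 1\<close> is left for a nonempty residual cell.\<close>

lemma emp_residual_cell:
  "residual_cell \<Omega> X x N \<noteq> {} \<Longrightarrow> emp \<Omega> X x N (residual_cell \<Omega> X x N) = 1 / real (N + 1)"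
  by (simp add: emp_def residual_cell_notin_data_cells sum_hits field_simps
      flip: sum_divide_distrib)

lemma emp_pos:
  assumes "1 \<le> N" "E \<in> cells \<Omega> X x N - {{}}"
  shows "0 < emp \<Omega> X x N E"
proof (cases "E \<in> data_cells \<Omega> X x N")
  case True
  then show ?thesis
    using assms(1) hits_pos[OF True] by (simp add: emp_def)
next
  case False
  then have "E = residual_cell \<Omega> X x N" "E \<noteq> {}"
    using assms(2) by (auto simp: cells_def)
  then show ?thesis
    by (simp add: emp_residual_cell)
qed

lemma sum_emp:
  assumes "\<forall>i\<ge>1. x i \<in> X ` \<Omega>" "1 \<le> N"
  shows "(\<Sum>E\<in>cells \<Omega> X x N - {{}}. emp \<Omega> X x N E) = 1"
proof (cases "residual_cell \<Omega> X x N = {}")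
  case True
  then have "cells \<Omega> X x N - {{}} = data_cells \<Omega> X x N"
    using data_cells_nonempty[OF assms(1)] by (auto simp: cells_def)
  then show ?thesis
    using True assms(2) by (simp add: emp_def sum_hits flip: sum_divide_distrib)
next
  case False
  then have "cells \<Omega> X x N - {{}} = insert (residual_cell \<Omega> X x N) (data_cells \<Omega> X x N)"
    using data_cells_nonempty[OF assms(1)] by (auto simp: cells_def)
  moreover have "(\<Sum>D\<in>data_cells \<Omega> X x N. emp \<Omega> X x N D) = real N / real (N + 1)"
    using False by (simp add: emp_def sum_hits flip: sum_divide_distrib)
  ultimately show ?thesis
    using False
    by (simp add: finite_data_cells residual_cell_notin_data_cells emp_residual_cell field_simps)
qed

section \<open>The update of a measure\<close>

lemma prob_measuresD:
  assumes "P \<in> prob_measures \<Omega>"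
  shows "prob_space P" "sets P = Pow \<Omega>" "space P = \<Omega>"
proof -
  show "prob_space P" and sets: "sets P = Pow \<Omega>"
    using assms by (auto simp: prob_measures_def)
  then show "space P = \<Omega>"
    using sets.top[of P] sets.sets_into_space[of \<Omega> P] by auto
qed

lemma cond_pr_bounds:
  assumes "P \<in> prob_measures \<Omega>" "E \<subseteq> \<Omega>"
  shows "0 \<le> cond_pr P A E" "cond_pr P A E \<le> 1"
proof -
  interpret prob_space P
    using assms(1) by (rule prob_measuresD)
  have "measure P (A \<inter> E) \<le> measure P E"
    using assms prob_measuresD[OF assms(1)] by (intro finite_measure_mono) auto
  then show "cond_pr P A E \<le> 1"
    by (auto simp: cond_pr_def divide_simps zero_less_measure_iff)
qed (simp add: cond_pr_def)

text \<open>A mixture of the set functions \<open>A \<mapsto> P(A | E)\<close> with nonnegative weights is countably additive,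
  so wrapping the update into a measure does not change its values.\<close>

lemma measure_dpk_update:
  assumes P: "P \<in> prob_measures \<Omega>" and A: "A \<subseteq> \<Omega>"
    and w: "\<And>E. E \<in> cells \<Omega> X x N - {{}} \<Longrightarrow> 0 \<le> \<beta> N * measure P E + (1 - \<beta> N) * emp \<Omega> X x N E"
  shows "measure (dpk_update \<Omega> X x \<beta> N P) A = (\<Sum>E\<in>cells \<Omega> X x N - {{}}.
    cond_pr P A E * (\<beta> N * measure P E + (1 - \<beta> N) * emp \<Omega> X x N E))"
proof -
  interpret prob_space P
    using P by (rule prob_measuresD)
  define f where "f A = (\<Sum>E\<in>cells \<Omega> X x N - {{}}.
    cond_pr P A E * (\<beta> N * measure P E + (1 - \<beta> N) * emp \<Omega> X x N E))" for A
  have f_nonneg: "0 \<le> f A" for A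
    unfolding f_def using w by (intro sum_nonneg mult_nonneg_nonneg) (auto simp: cond_pr_def)
  have f_sums: "(\<lambda>i. f (F i)) sums f (\<Union>i. F i)"
    if F: "range F \<subseteq> Pow \<Omega>" "disjoint_family F" for F :: "nat \<Rightarrow> _"
  proof -
    have "(\<lambda>i. measure P (F i \<inter> E)) sums measure P (\<Union>i. F i \<inter> E)" for E
    proof (rule finite_measure_UNION)
      show "disjoint_family (\<lambda>i. F i \<inter> E)"
        using F(2) unfolding disjoint_family_on_def by blast
      show "range (\<lambda>i. F i \<inter> E) \<subseteq> sets P"
        using F(1) prob_measuresD(2)[OF P] by auto
    qed
    then have "(\<lambda>i. cond_pr P (F i) E) sums cond_pr P (\<Union>i. F i) E" for E
      unfolding cond_pr_def by (simp add: sums_divide)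
    then show ?thesis
      unfolding f_def by (intro sums_sum sums_mult2)
  qed
  have "emeasure (measure_of \<Omega> (Pow \<Omega>) (\<lambda>A. ennreal (f A))) A = ennreal (f A)"
  proof (rule emeasure_measure_of_sigma)
    show "sigma_algebra \<Omega> (Pow \<Omega>)"
      by (rule sigma_algebra_Pow)
    show "positive (Pow \<Omega>) (\<lambda>A. ennreal (f A))"
      by (simp add: positive_def f_def cond_pr_def)
    show "countably_additive (Pow \<Omega>) (\<lambda>A. ennreal (f A))"
      unfolding countably_additive_def
      using f_sums f_nonneg by (auto intro!: suminf_ennreal_eq)
    show "A \<in> Pow \<Omega>"
      using A by simp
  qed
  then show ?thesis
    unfolding dpk_update_def f_def[symmetric] by (simp add: measure_def f_nonneg)
qed

definition positive_prob_measures :: "'w set \<Rightarrow> 'w measure set" where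
  "positive_prob_measures \<Omega> = {P \<in> prob_measures \<Omega>. \<forall>S\<subseteq>\<Omega>. S \<noteq> {} \<longrightarrow> 0 < measure P S}"

lemma positive_prob_measuresD:
  assumes "P \<in> positive_prob_measures \<Omega>"
  shows "P \<in> prob_measures \<Omega>" "S \<subseteq> \<Omega> \<Longrightarrow> S \<noteq> {} \<Longrightarrow> 0 < measure P S"
  using assms by (auto simp: positive_prob_measures_def)

text \<open>The weights are convex combinations of two positive numbers, which stay positive even at the
  endpoints \<open>\<beta> = 0\<close> and \<open>\<beta> = 1\<close>. Conditioning on a nonempty cell is then well defined, so the
  total mass is the sum of the weights, and an event meeting a cell gets positive mass from it.\<close>

lemma dpk_update_positive_prob_measures:
  assumes P: "P \<in> positive_prob_measures \<Omega>" and x: "\<forall>i\<ge>1. x i \<in> X ` \<Omega>"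
    and N: "1 \<le> N" and \<beta>: "0 \<le> \<beta> N" "\<beta> N \<le> 1"
  shows "dpk_update \<Omega> X x \<beta> N P \<in> positive_prob_measures \<Omega>"
proof -
  let ?C = "cells \<Omega> X x N - {{}}" and ?Q = "dpk_update \<Omega> X x \<beta> N P"
  define w where "w E = \<beta> N * measure P E + (1 - \<beta> N) * emp \<Omega> X x N E" for E
  note P' = positive_prob_measuresD(1)[OF P]
  interpret prob_space P
    using P' by (rule prob_measuresD)
  have P_pos: "0 < measure P E" if "E \<in> ?C" for E
    using that by (intro positive_prob_measuresD(2)[OF P] cells_subset) auto
  have w_pos: "0 < w E" if "E \<in> ?C" for E
  proof (cases "\<beta> N = 0")
    case True
    then show ?thesis
      using emp_pos[OF N that] by (simp add: w_def)
  next
    case False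
    then show ?thesis
      unfolding w_def using emp_pos[OF N that] P_pos[OF that] \<beta>
      by (intro add_pos_nonneg) auto
  qed
  have Q: "measure ?Q A = (\<Sum>E\<in>?C. cond_pr P A E * w E)" if "A \<subseteq> \<Omega>" for A
    unfolding w_def
  proof (rule measure_dpk_update[OF P' that])
    show "0 \<le> \<beta> N * measure P E + (1 - \<beta> N) * emp \<Omega> X x N E" if "E \<in> ?C" for E
      using w_pos[OF that] by (simp add: w_def)
  qed
  have sets_Q: "sets ?Q = Pow \<Omega>"
    by (simp add: dpk_update_def sigma_algebra.sigma_sets_eq[OF sigma_algebra_Pow])
  have space_Q: "space ?Q = \<Omega>"
    by (simp add: dpk_update_def)
  have "measure P (\<Union>E\<in>?C. E) = (\<Sum>E\<in>?C. measure P E)"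
  proof (rule finite_measure_finite_Union)
    show "disjoint_family_on (\<lambda>E. E) ?C"
      using disjoint_cells[of \<Omega> X x N] by (auto simp: disjoint_family_on_def disjoint_def)
    show "(\<lambda>E. E) ` ?C \<subseteq> sets P"
      using prob_measuresD(2)[OF P'] by (auto dest: cells_subset)
  qed (simp add: finite_cells)
  then have "(\<Sum>E\<in>?C. measure P E) = 1"
    using prob_measuresD(3)[OF P'] prob_space by (simp add: Union_cells)
  then have sum_w: "(\<Sum>E\<in>?C. w E) = 1"
    by (simp add: w_def sum.distrib sum_emp[OF x N] flip: sum_distrib_left)
  have "cond_pr P \<Omega> E = 1" if "E \<in> ?C" for E
  proof -
    have "\<Omega> \<inter> E = E"
      using that cells_subset[of E \<Omega> X x N] by blast
    then show ?thesis
      using P_pos[OF that] by (simp add: cond_pr_def)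
  qed
  then have "measure ?Q \<Omega> = 1"
    by (simp add: Q sum_w)
  \<comment> \<open>\<^const>\<open>measure\<close> sends infinite mass to \<open>0\<close>, so a value \<open>1\<close> already excludes it.\<close>
  then have "emeasure ?Q \<Omega> \<noteq> \<top>"
    by (auto simp: measure_def)
  then have "emeasure ?Q \<Omega> = 1"
    using \<open>measure ?Q \<Omega> = 1\<close> by (simp add: emeasure_eq_ennreal_measure)
  then have "prob_space ?Q"
    by (intro prob_spaceI) (simp add: space_Q)
  moreover have "0 < measure ?Q S" if S: "S \<subseteq> \<Omega>" "S \<noteq> {}" for S
  proof -
    obtain \<omega> E where E: "\<omega> \<in> S" "\<omega> \<in> E" "E \<in> ?C"
      using S Union_cells[of \<Omega> X x N] by blast
    have "0 < measure P (S \<inter> E)"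
    proof (rule positive_prob_measuresD(2)[OF P])
      show "S \<inter> E \<subseteq> \<Omega>" "S \<inter> E \<noteq> {}"
        using S(1) E(1,2) by blast+
    qed
    then have cond_pos: "0 < cond_pr P S E"
      using P_pos[OF E(3)] by (simp add: cond_pr_def)
    have "0 < (\<Sum>E\<in>?C. cond_pr P S E * w E)"
    proof (rule sum_pos2[OF _ E(3)])
      show "0 < cond_pr P S E * w E"
        using cond_pos w_pos[OF E(3)] by (rule mult_pos_pos)
      show "0 \<le> cond_pr P S D * w D" if "D \<in> ?C" for D
        using w_pos[OF that] by (simp add: cond_pr_def)
    qed (simp add: finite_cells)
    then show ?thesis
      by (simp add: Q S)
  qed
  ultimately show ?thesis
    by (simp add: positive_prob_measures_def prob_measures_def sets_Q)
qed

section \<open>Lower and upper envelopes\<close>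

lemma envelope_bounds:
  assumes C: "C \<subseteq> prob_measures \<Omega>" and P: "P \<in> C" and E: "E \<subseteq> \<Omega>"
  shows "0 \<le> lower_prob C E" "lower_prob C E \<le> measure P E" "measure P E \<le> upper_prob C E"
    "0 \<le> lower_bayes C A E" "lower_bayes C A E \<le> cond_pr P A E"
    "cond_pr P A E \<le> upper_bayes C A E"
proof -
  have prob: "measure Q E \<le> 1" if "Q \<in> C" for Q
    using C that prob_measuresD(1) prob_space.prob_le_1 by blast
  have cond: "cond_pr Q A E \<le> 1" if "Q \<in> C" for Q
    using C that E cond_pr_bounds(2) by blast
  have "bdd_below ((\<lambda>P. measure P E) ` C)" "bdd_below ((\<lambda>P. cond_pr P A E) ` C)"
    by (auto intro!: bdd_belowI[where m = 0] simp: cond_pr_def)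
  then show "lower_prob C E \<le> measure P E" "lower_bayes C A E \<le> cond_pr P A E"
    unfolding lower_prob_def lower_bayes_def using P by (auto intro: cINF_lower)
  have "bdd_above ((\<lambda>P. measure P E) ` C)" "bdd_above ((\<lambda>P. cond_pr P A E) ` C)"
    using prob cond by (auto intro!: bdd_aboveI[where M = 1])
  then show "measure P E \<le> upper_prob C E" "cond_pr P A E \<le> upper_bayes C A E"
    unfolding upper_prob_def upper_bayes_def using P by (auto intro: cSUP_upper)
  show "0 \<le> lower_prob C E" "0 \<le> lower_bayes C A E"
    unfolding lower_prob_def lower_bayes_def
    using P by (auto intro!: cINF_greatest simp: cond_pr_def)
qed

text \<open>Conditional probabilities, weights and their envelopes are all nonnegative, so each term
  of the update is monotone in both of its factors, which can be bounded independently.\<close>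

lemma
  assumes C: "C \<subseteq> prob_measures \<Omega>" and P: "P \<in> C" and A: "A \<subseteq> \<Omega>"
    and N: "1 \<le> N" and \<beta>: "0 \<le> \<beta> N" "\<beta> N \<le> 1"
  shows dpk_update_ge: "(\<Sum>E\<in>cells \<Omega> X x N - {{}}. lower_bayes C A E *
      (\<beta> N * lower_prob C E + (1 - \<beta> N) * emp \<Omega> X x N E))
      \<le> measure (dpk_update \<Omega> X x \<beta> N P) A" (is ?ge)
    and dpk_update_le: "measure (dpk_update \<Omega> X x \<beta> N P) A
      \<le> (\<Sum>E\<in>cells \<Omega> X x N - {{}}. upper_bayes C A E *
      (\<beta> N * upper_prob C E + (1 - \<beta> N) * emp \<Omega> X x N E))" (is ?le)
proof -
  let ?C = "cells \<Omega> X x N - {{}}"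
  have emp: "0 \<le> emp \<Omega> X x N E" if "E \<in> ?C" for E
    using emp_pos[OF N that] by simp
  have Q: "measure (dpk_update \<Omega> X x \<beta> N P) A = (\<Sum>E\<in>?C.
      cond_pr P A E * (\<beta> N * measure P E + (1 - \<beta> N) * emp \<Omega> X x N E))"
    using C P A emp \<beta> by (intro measure_dpk_update add_nonneg_nonneg mult_nonneg_nonneg) auto
  have E: "E \<subseteq> \<Omega>" if "E \<in> ?C" for E
    using that cells_subset by blast
  note bounds = envelope_bounds[OF C P E]
  show ?ge
    unfolding Q using \<beta> emp bounds
    by (intro sum_mono mult_mono add_mono mult_left_mono add_nonneg_nonneg mult_nonneg_nonneg)
      (auto simp: cond_pr_def)
  have "0 \<le> upper_bayes C A E" if "E \<in> ?C" for E
    using bounds(4,5,6)[OF that, of A] by linarith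
  then show ?le
    unfolding Q using \<beta> emp bounds
    by (intro sum_mono mult_mono add_mono mult_left_mono add_nonneg_nonneg mult_nonneg_nonneg)
      (auto simp: cond_pr_def)
qed

section \<open>Convex hulls and belief sets\<close>

lemma conv_ge:
  assumes "P \<in> conv \<Omega> C" "A \<subseteq> \<Omega>" "\<And>Q. Q \<in> C \<Longrightarrow> c \<le> measure Q A"
  shows "c \<le> measure P A"
proof -
  obtain F u where u: "F \<subseteq> C" "\<forall>Q\<in>F. 0 \<le> u Q" "(\<Sum>Q\<in>F. u Q) = 1"
    "measure P A = (\<Sum>Q\<in>F. u Q * measure Q A)"
    using assms(1,2) unfolding conv_def by auto
  have "(\<Sum>Q\<in>F. u Q * c) \<le> (\<Sum>Q\<in>F. u Q * measure Q A)"
    using u assms(3) by (intro sum_mono mult_left_mono) auto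
  then show ?thesis
    using u by (simp flip: sum_distrib_right)
qed

lemma conv_le:
  assumes "P \<in> conv \<Omega> C" "A \<subseteq> \<Omega>" "\<And>Q. Q \<in> C \<Longrightarrow> measure Q A \<le> c"
  shows "measure P A \<le> c"
proof -
  obtain F u where u: "F \<subseteq> C" "\<forall>Q\<in>F. 0 \<le> u Q" "(\<Sum>Q\<in>F. u Q) = 1"
    "measure P A = (\<Sum>Q\<in>F. u Q * measure Q A)"
    using assms(1,2) unfolding conv_def by auto
  have "(\<Sum>Q\<in>F. u Q * measure Q A) \<le> (\<Sum>Q\<in>F. u Q * c)"
    using u assms(3) by (intro sum_mono mult_left_mono) auto
  then show ?thesis
    using u by (simp flip: sum_distrib_right)
qed

lemma subset_conv:
  assumes "C \<subseteq> prob_measures \<Omega>"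
  shows "C \<subseteq> conv \<Omega> C"
proof
  fix P assume "P \<in> C"
  then show "P \<in> conv \<Omega> C"
    using assms by (auto simp: conv_def intro!: exI[of _ "{P}"] exI[of _ "\<lambda>_. 1"])
qed

lemma conv_empty: "conv \<Omega> {} = {}"
  by (simp add: conv_def)

text \<open>The prior set \<open>\<P>\<close> lies in the core, so the core is nonempty; being the hull of its extreme
  points, it has at least one.\<close>

lemma dipk_extremes_nonempty:
  assumes "\<P> \<subseteq> prob_measures \<Omega>" "\<P> \<noteq> {}"
    and hull: "dipk_beliefs \<Omega> X x n \<beta> \<P> 0 = conv \<Omega> (dipk_extremes \<Omega> X x n \<beta> \<P> 0)"
  shows "dipk_extremes \<Omega> X x n \<beta> \<P> t \<noteq> {}"
proof (induction t)
  case 0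
  obtain P where P: "P \<in> \<P>"
    using assms(2) by blast
  have "lower_prob \<P> A \<le> measure P A" if "A \<subseteq> \<Omega>" for A
    using envelope_bounds(2)[OF assms(1) P that] .
  then have "P \<in> dipk_beliefs \<Omega> X x n \<beta> \<P> 0"
    using P assms(1) by (auto simp: dipk_beliefs_def core_def)
  then have "conv \<Omega> (dipk_extremes \<Omega> X x n \<beta> \<P> 0) \<noteq> {}"
    unfolding hull[symmetric] by blast
  then show ?case
    by (metis conv_empty)
next
  case (Suc t)
  then show ?case
    by simp
qed

lemma dipk_extremes_positive:
  assumes x: "\<forall>i\<ge>1. x i \<in> X ` \<Omega>" and n: "strict_mono n"
    and \<beta>: "\<forall>k\<ge>1. 0 \<le> \<beta> k \<and> \<beta> k \<le> 1"
    and pos: "\<forall>P \<in> dipk_extremes \<Omega> X x n \<beta> \<P> 0. \<forall>S\<subseteq>\<Omega>. S \<noteq> {} \<longrightarrow> 0 < measure P S"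
  shows "dipk_extremes \<Omega> X x n \<beta> \<P> t \<subseteq> positive_prob_measures \<Omega>"
proof (induction t)
  case 0
  then show ?case
    using pos by (auto simp: positive_prob_measures_def extreme_points_def core_def)
next
  case (Suc t)
  have "1 \<le> n (Suc t)"
    using strict_mono_imp_increasing[OF n, of "Suc t"] by simp
  then show ?case
    using Suc \<beta> by (auto intro!: dpk_update_positive_prob_measures x)
qed

theorem proposition17:
  fixes \<Omega> :: "'w set" and X :: "'w \<Rightarrow> 'x" and x :: "nat \<Rightarrow> 'x"
    and n :: "nat \<Rightarrow> nat" and \<beta> :: "nat \<Rightarrow> real" and \<P> :: "'w measure set"
    and A :: "'w set" and t :: nat
  assumes "countable \<Omega>"
    and "\<forall>i\<ge>1. x i \<in> X ` \<Omega>"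
    and "n 0 = 0" and "strict_mono n"
    and "\<forall>k\<ge>1. 0 \<le> \<beta> k \<and> \<beta> k \<le> 1"
    and "\<P> \<subseteq> prob_measures \<Omega>" and "\<P> \<noteq> {}"
    and "finite (dipk_extremes \<Omega> X x n \<beta> \<P> 0)"
    and "dipk_beliefs \<Omega> X x n \<beta> \<P> 0 = conv \<Omega> (dipk_extremes \<Omega> X x n \<beta> \<P> 0)"
    and "\<forall>P \<in> dipk_extremes \<Omega> X x n \<beta> \<P> 0. \<forall>S\<subseteq>\<Omega>. S \<noteq> {} \<longrightarrow> 0 < measure P S"
    and "A \<subseteq> \<Omega>" and "1 \<le> t"
  defines "B \<equiv> dipk_beliefs \<Omega> X x n \<beta> \<P>"
    and "N \<equiv> n (t + 1)"
  shows "(\<Sum>E \<in> cells \<Omega> X x N - {{}}. lower_bayes (B t) A E *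
            (\<beta> N * lower_prob (B t) E + (1 - \<beta> N) * emp \<Omega> X x N E))
          \<le> lower_prob (B (t + 1)) A
       \<and> upper_prob (B (t + 1)) A
          \<le> (\<Sum>E \<in> cells \<Omega> X x N - {{}}. upper_bayes (B t) A E *
            (\<beta> N * upper_prob (B t) E + (1 - \<beta> N) * emp \<Omega> X x N E))"
proof -
  let ?K = "dipk_extremes \<Omega> X x n \<beta> \<P>"
  have K: "?K s \<subseteq> prob_measures \<Omega>" for s
    using dipk_extremes_positive[OF assms(2,4,5,10), of s]
    by (auto simp only: positive_prob_measures_def)
  have B: "B s = conv \<Omega> (?K s)" if "1 \<le> s" for s
    using that by (simp add: B_def dipk_beliefs_def)
  have B_prob: "B t \<subseteq> prob_measures \<Omega>"
    using \<open>1 \<le> t\<close> by (auto simp: B conv_def)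
  have K_B: "?K s \<subseteq> B s" if "1 \<le> s" for s
    unfolding B[OF that] by (rule subset_conv[OF K])
  have N: "1 \<le> N"
    using strict_mono_imp_increasing[OF \<open>strict_mono n\<close>, of "t + 1"] by (simp add: N_def)
  then have \<beta>: "0 \<le> \<beta> N" "\<beta> N \<le> 1"
    using assms(5) by auto
  have K_Suc: "?K (t + 1) = dpk_update \<Omega> X x \<beta> N ` ?K t"
    by (simp add: N_def)
  have nonempty: "B (t + 1) \<noteq> {}"
    using dipk_extremes_nonempty[OF assms(6,7,9)] K_B[of "t + 1"]
    by (metis le_add2 subset_empty)
  let ?L = "\<Sum>E \<in> cells \<Omega> X x N - {{}}. lower_bayes (B t) A E *
    (\<beta> N * lower_prob (B t) E + (1 - \<beta> N) * emp \<Omega> X x N E)"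
  let ?U = "\<Sum>E \<in> cells \<Omega> X x N - {{}}. upper_bayes (B t) A E *
    (\<beta> N * upper_prob (B t) E + (1 - \<beta> N) * emp \<Omega> X x N E)"
  have extreme: "?L \<le> measure Q A \<and> measure Q A \<le> ?U" if Q: "Q \<in> ?K (t + 1)" for Q
  proof -
    obtain R where R: "R \<in> B t" "Q = dpk_update \<Omega> X x \<beta> N R"
      using Q K_B[OF \<open>1 \<le> t\<close>] unfolding K_Suc by blast
    show ?thesis
      unfolding R(2)
      using dpk_update_ge[where \<beta> = \<beta>, OF B_prob R(1) \<open>A \<subseteq> \<Omega>\<close> N \<beta>]
        dpk_update_le[where \<beta> = \<beta>, OF B_prob R(1) \<open>A \<subseteq> \<Omega>\<close> N \<beta>] by blast
  qed
  have belief: "?L \<le> measure P A \<and> measure P A \<le> ?U" if "P \<in> B (t + 1)" for P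
  proof -
    have P: "P \<in> conv \<Omega> (?K (t + 1))"
      using that B[of "t + 1"] by simp
    show ?thesis
      using conv_ge[OF P \<open>A \<subseteq> \<Omega>\<close>, of ?L] conv_le[OF P \<open>A \<subseteq> \<Omega>\<close>, of ?U] extreme by blast
  qed
  have "?L \<le> lower_prob (B (t + 1)) A"
    unfolding lower_prob_def[of "B (t + 1)"] using nonempty belief by (auto intro: cINF_greatest)
  moreover have "upper_prob (B (t + 1)) A \<le> ?U"
    unfolding upper_prob_def[of "B (t + 1)"] using nonempty belief by (auto intro: cSUP_least)
  ultimately show ?thesis ..
qed

end
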